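(* For any integer $k\ge 2$ and any positive integer $n$ that is a multiple of $k-1$, there exists a connected interval graph $G$ on $n+1$ vertices and of pathwidth $k-1$ such that $\delta(\mathcal{A}(G))\ge nk/2$.
   Context: For a connected graph $G=(V,E)$, a search tree on $G$ is a rooted tree with vertex set $V$ defined recursively: its root is some vertex $r\in V$, and $r$ is joined to the roots of search trees on each connected component of $G-r$. The tubes of a search tree are the vertex sets of its subtrees. Two search trees on $G$ are related by a rotation if their sets of tubes have symmetric difference of size exactly two. The graph associahedron $\mathcal{A}(G)$ is a polytope whose skeleton is isomorphic to the graph on search trees of $G$ with adjacency given by rotations; $\delta(\mathcal{A}(G))$ is the diameter of this graph. Pathwidth is the usual graph parameter. *)

theory Defs
  imports "Graph_Theory.Graph_Theory" "HOL-Library.FSet"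
begin

(* Finite simple graphs are digraphs in the locale graph (finite, symmetric, without
   loops or parallel arcs): an edge uv is the pair of arcs u \<rightarrow> v and v \<rightarrow> u. *)

section \<open>Interval graphs and pathwidth\<close>

definition interval_graph :: "('a, 'b) pre_digraph \<Rightarrow> bool" where
  "interval_graph G \<longleftrightarrow>
     (\<exists>l h :: 'a \<Rightarrow> real.
        (\<forall>v \<in> verts G. l v \<le> h v) \<and>
        (\<forall>u \<in> verts G. \<forall>v \<in> verts G. u \<noteq> v \<longrightarrow>
           (u \<rightarrow>\<^bsub>G\<^esub> v \<longleftrightarrow> {l u..h u} \<inter> {l v..h v} \<noteq> {})))"

definition path_decomposition :: "('a, 'b) pre_digraph \<Rightarrow> 'a set list \<Rightarrow> bool" where
  "path_decomposition G Xs \<longleftrightarrow>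
     Xs \<noteq> [] \<and>
     (\<Union>X \<in> set Xs. X) = verts G \<and>
     (\<forall>u v. u \<rightarrow>\<^bsub>G\<^esub> v \<longrightarrow> (\<exists>X \<in> set Xs. u \<in> X \<and> v \<in> X)) \<and>
     (\<forall>i j m. i \<le> j \<and> j \<le> m \<and> m < length Xs \<longrightarrow> Xs ! i \<inter> Xs ! m \<subseteq> Xs ! j)"

definition width :: "'a set list \<Rightarrow> nat" where
  "width Xs = Max (card ` set Xs) - 1"

definition pathwidth :: "('a, 'b) pre_digraph \<Rightarrow> nat" where
  "pathwidth G = (LEAST w. \<exists>Xs. path_decomposition G Xs \<and> width Xs = w)"

section \<open>Search trees and rotations\<close>

(* Children form a finite set, so that trees are rooted but unordered. *)
datatype (tree_verts: 'a) rtree = Node 'a "'a rtree fset"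

(* G is symmetric here, so the strongly connected components of G - r are its connected
   components; f picks the search tree on each of them. *)
inductive search_tree :: "('a, 'b) pre_digraph \<Rightarrow> 'a rtree \<Rightarrow> bool" where
  "\<lbrakk> r \<in> verts G;
     \<And>H. H \<in> pre_digraph.sccs (pre_digraph.del_vert G r) \<Longrightarrow> search_tree H (f H);
     fset ts = f ` pre_digraph.sccs (pre_digraph.del_vert G r) \<rbrakk>
   \<Longrightarrow> search_tree G (Node r ts)"

primrec subtrees :: "'a rtree \<Rightarrow> 'a rtree set" where
  "subtrees (Node r ts) = insert (Node r ts) (\<Union>(fset (subtrees |`| ts)))"

definition tubes :: "'a rtree \<Rightarrow> 'a set set" where
  "tubes T = tree_verts ` subtrees T"

definition rotation :: "'a rtree \<Rightarrow> 'a rtree \<Rightarrow> bool" where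
  "rotation S T \<longleftrightarrow> card ((tubes S - tubes T) \<union> (tubes T - tubes S)) = 2"

(* The skeleton of the graph associahedron of G. *)
definition rotation_graph :: "('a, 'b) pre_digraph \<Rightarrow> 'a rtree pair_pre_digraph" where
  "rotation_graph G =
     \<lparr> pverts = {T. search_tree G T},
       parcs = {(S, T). search_tree G S \<and> search_tree G T \<and> rotation S T} \<rparr>"

lemma pair_sym_digraph_rotation_graph: "pair_sym_digraph (rotation_graph G)"
  by unfold_locales
    (auto simp: rotation_graph_def rotation_def symmetric_def Un_commute intro!: symI)

(* With unit weights, \<mu> is the graph distance (infinite between different components). *)
definition diameter :: "('a, 'b) pre_digraph \<Rightarrow> ereal" where
  "diameter G = (SUP u \<in> verts G. SUP v \<in> verts G. wf_digraph.\<mu> G (\<lambda>_. 1) u v)"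

end

theory Submission
  imports Defs
begin

text \<open>The ends of an edge of \<open>G\<close> are comparable in every search tree, so a search tree orients the
  edges of \<open>G\<close> from ancestor to descendant. A rotation replaces one tube \<open>A\<close> by one tube \<open>B\<close>, and an
  edge reversed by it joins the root of \<open>A\<close> to the root of \<open>B\<close>; so it reverses at most one edge.
  Eliminating the vertices in two opposite orders gives two search trees in which all edges are
  oriented oppositely, hence the diameter is at least the number of edges. Gluing \<open>n / (k - 1)\<close>
  cliques of size \<open>k\<close> along a common vertex gives an interval graph of pathwidth \<open>k - 1\<close> with
  \<open>n / (k - 1) \<cdot> k (k - 1) / 2 = n k / 2\<close> edges.\<close>

section \<open>Tubes of search trees\<close>

lemma (in pseudo_graph) pseudo_graph_del_vert: "pseudo_graph (del_vert r)"
proof -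
  interpret D: fin_digraph "del_vert r" by (rule fin_digraph_del_vert)
  have "sym_digraph (del_vert r)"
    using sym_arcs
    by unfold_locales (force simp: symmetric_def sym_def arcs_ends_conv del_vert_simps)
  then show ?thesis
    by (simp add: pseudo_graph_def D.fin_digraph_axioms)
qed

lemma (in pseudo_graph) pseudo_graph_sccs:
  assumes "H \<in> sccs"
  shows "pseudo_graph H"
proof -
  have ind: "induced_subgraph H G" using assms by (rule in_sccs_imp_induced)
  have "wf_digraph H" using ind by (auto simp: induced_subgraph_def subgraph_def)
  moreover have "sym_digraph H"
    using sym_arcs ind \<open>wf_digraph H\<close>
    by (force simp: sym_digraph_def sym_digraph_axioms_def symmetric_def sym_def arcs_ends_conv
        induced_subgraph_def subgraph_def compatible_def)
  moreover have "finite (verts H)" "finite (arcs H)"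
    using ind by (auto simp: induced_subgraph_def subgraph_def intro: finite_subset)
  ultimately show ?thesis
    by (simp add: pseudo_graph_def fin_digraph_def fin_digraph_axioms_def)
qed

lemma (in pseudo_graph) Union_verts_sccs: "(\<Union>H\<in>sccs. verts H) = verts G"
  using graph_is_union_sccs by (metis Union_def pre_digraph.select_convs(1))

text \<open>In a symmetric digraph no arc runs between different strong components, so each arc lies
  in one of them; disjointness of the components identifies that one with \<open>H\<close>.\<close>

lemma (in pseudo_graph) arc_in_scc:
  assumes H: "H \<in> sccs" and uv: "u \<rightarrow>\<^bsub>G\<^esub> v" and mem: "u \<in> verts H \<or> v \<in> verts H"
  shows "u \<rightarrow>\<^bsub>H\<^esub> v"
proof -
  obtain K where K: "K \<in> sccs" "u \<rightarrow>\<^bsub>K\<^esub> v"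
  proof -
    obtain e where e: "e \<in> arcs G" "tail G e = u" "head G e = v" using uv by auto
    then have "e \<in> (\<Union>K\<in>sccs. arcs K)"
      using graph_is_union_sccs by (metis Union_def pre_digraph.select_convs(2))
    then obtain K where K: "K \<in> sccs" "e \<in> arcs K" by auto
    then have "tail K e = u" "head K e = v"
      using e in_sccs_imp_induced[OF K(1)]
      by (auto simp: induced_subgraph_def subgraph_def compatible_def)
    with K show ?thesis using that by (auto simp: arcs_ends_conv image_iff intro!: bexI[of _ e])
  qed
  interpret K: pseudo_graph K using K(1) by (rule pseudo_graph_sccs)
  have "u \<in> verts K" "v \<in> verts K" using K(2) by auto
  then have "H = K" using scc_disj[OF H K(1)] mem by auto
  then show ?thesis using K by simp
qed

section \<open>Recursive structure of tubes and the ancestor relation\<close>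

lemma tubes_Node:
  "tubes (Node r ts) = insert (tree_verts (Node r ts)) (\<Union>t\<in>fset ts. tubes t)"
  by (auto simp: tubes_def)

lemma tree_verts_search_tree:
  assumes "search_tree G T" "pseudo_graph G"
  shows "tree_verts T = verts G"
  using assms
proof (induction rule: search_tree.induct)
  case (1 r G f ts)
  interpret pseudo_graph G by fact
  interpret D: pseudo_graph "del_vert r" by (rule pseudo_graph_del_vert)
  have "tree_verts (f H) = verts H" if "H \<in> D.sccs" for H
    using 1 that D.pseudo_graph_sccs by blast
  then have "(\<Union>t\<in>fset ts. tree_verts t) = verts G - {r}"
    using 1 D.Union_verts_sccs by (simp add: verts_del_vert)
  then show ?case using 1(1) by auto
qed

lemma tubes_subset_verts:
  assumes "search_tree G T" "pseudo_graph G" "X \<in> tubes T"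
  shows "X \<subseteq> verts G"
proof -
  have "tree_verts t \<subseteq> tree_verts T" if "t \<in> subtrees T" for t T :: "'a rtree"
    using that by (induction T) fastforce
  then show ?thesis
    using assms tree_verts_search_tree[OF assms(1,2)] by (auto simp: tubes_def)
qed

text \<open>This packages the recursion in terms of tubes: the components partition
  \<open>verts G - {r}\<close>, arcs avoiding \<open>r\<close> stay inside them, and each tube other
  than \<open>verts G\<close> comes from the search tree on one component. The inductions below can
  thus argue with vertex sets alone.\<close>

lemma search_tree_tubes_induct [consumes 2, case_names tree]:
  assumes "search_tree G T" "pseudo_graph G"
    and step: "\<And>G T r f. \<lbrakk>pseudo_graph G; r \<in> verts G;
      \<Union>(verts ` pre_digraph.sccs (pre_digraph.del_vert G r)) = verts G - {r};
      \<And>H K. \<lbrakk>H \<in> pre_digraph.sccs (pre_digraph.del_vert G r);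
        K \<in> pre_digraph.sccs (pre_digraph.del_vert G r); H \<noteq> K\<rbrakk> \<Longrightarrow> verts H \<inter> verts K = {};
      \<And>H u v. \<lbrakk>H \<in> pre_digraph.sccs (pre_digraph.del_vert G r); u \<rightarrow>\<^bsub>G\<^esub> v; u \<noteq> r; v \<noteq> r;
        u \<in> verts H \<or> v \<in> verts H\<rbrakk> \<Longrightarrow> u \<rightarrow>\<^bsub>H\<^esub> v \<and> u \<in> verts H \<and> v \<in> verts H;
      tubes T = insert (verts G) (\<Union>H\<in>pre_digraph.sccs (pre_digraph.del_vert G r). tubes (f H));
      \<And>H. H \<in> pre_digraph.sccs (pre_digraph.del_vert G r) \<Longrightarrow> verts H \<in> tubes (f H);
      \<And>H X. \<lbrakk>H \<in> pre_digraph.sccs (pre_digraph.del_vert G r); X \<in> tubes (f H)\<rbrakk> \<Longrightarrow> X \<subseteq> verts H;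
      \<And>H. H \<in> pre_digraph.sccs (pre_digraph.del_vert G r) \<Longrightarrow> P H (f H)\<rbrakk> \<Longrightarrow> P G T"
  shows "P G T"
  using assms(1,2)
proof (induction rule: search_tree.induct)
  case (1 r G f ts)
  interpret pseudo_graph G by fact
  interpret D: pseudo_graph "del_vert r" by (rule pseudo_graph_del_vert)
  have arcs: "u \<rightarrow>\<^bsub>H\<^esub> v \<and> u \<in> verts H \<and> v \<in> verts H"
    if "H \<in> D.sccs" "u \<rightarrow>\<^bsub>G\<^esub> v" "u \<noteq> r" "v \<noteq> r" "u \<in> verts H \<or> v \<in> verts H" for H u v
  proof -
    have "u \<rightarrow>\<^bsub>del_vert r\<^esub> v" using that(2-4) by (force simp: arcs_ends_conv del_vert_simps)
    then have "u \<rightarrow>\<^bsub>H\<^esub> v" using D.arc_in_scc that(1,5) by blast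
    interpret H: pseudo_graph H using that(1) by (rule D.pseudo_graph_sccs)
    show ?thesis using \<open>u \<rightarrow>\<^bsub>H\<^esub> v\<close> by auto
  qed
  have top: "verts H \<in> tubes (f H)" if "H \<in> D.sccs" for H
  proof -
    have "T \<in> subtrees T" for T :: "'a rtree" by (cases T) auto
    then show ?thesis
      using tree_verts_search_tree[OF _ D.pseudo_graph_sccs[OF that]] 1(2)[OF that]
      by (force simp: tubes_def)
  qed
  have "search_tree G (Node r ts)" using 1 by (auto intro: search_tree.intros)
  from tree_verts_search_tree[OF this pseudo_graph_axioms]
  have tubes: "tubes (Node r ts) = insert (verts G) (\<Union>H\<in>D.sccs. tubes (f H))"
    using \<open>fset ts = f ` D.sccs\<close> by (simp add: tubes_Node del: rtree.set)
  show ?case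
  proof (rule step[OF pseudo_graph_axioms \<open>r \<in> verts G\<close> _ D.scc_disj arcs tubes top])
    show "\<Union> (verts ` D.sccs) = verts G - {r}"
      using D.Union_verts_sccs by (simp add: verts_del_vert)
    show "X \<subseteq> verts H" if "H \<in> D.sccs" "X \<in> tubes (f H)" for H X
      using tubes_subset_verts 1(2) D.pseudo_graph_sccs that by blast
    show "P H (f H)" if "H \<in> D.sccs" for H
      using 1 D.pseudo_graph_sccs that by blast
  qed auto
qed

text \<open>One of the two vertices, say \<open>u\<close>, is not the root \<open>r\<close>. Its
  component of \<open>G - r\<close> either misses \<open>v\<close>, and is then a separating tube,
  or contains \<open>v\<close>, and induction applies.\<close>

lemma tubes_separate:
  assumes "search_tree G T" "pseudo_graph G" "u \<in> verts G" "v \<in> verts G" "u \<noteq> v"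
  shows "\<exists>X\<in>tubes T. (u \<in> X) \<noteq> (v \<in> X)"
  using assms
proof (induction arbitrary: u v rule: search_tree_tubes_induct)
  case (tree G T r f)
  have ex: "\<exists>H\<in>pre_digraph.sccs (pre_digraph.del_vert G r). w \<in> verts H" 
    if "w \<in> verts G" "w \<noteq> r" for w using tree(3) that by blast
  have *: "\<exists>X\<in>tubes T. (u \<in> X) \<noteq> (v \<in> X)" 
    if uv: "u \<in> verts G" "v \<in> verts G" "u \<noteq> v" "u \<noteq> r" for u v
  proof -
    obtain H where H: "H \<in> pre_digraph.sccs (pre_digraph.del_vert G r)" "u \<in> verts H"
      using ex[OF uv(1,4)] by blast
    then have sub: "tubes (f H) \<subseteq> tubes T" using tree(6) by blast
    show ?thesis
    proof (cases "v \<in> verts H")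
      case True
      then show ?thesis using tree(9)[OF H(1) H(2) True uv(3)] sub by blast
    next
      case False
      then show ?thesis using tree(7)[OF H(1)] H(2) sub by blast
    qed
  qed
  show ?case using *[of u v] *[of v u] tree(10-12) by metis
qed

text \<open>The witness is the root of the subtree spanning \<open>A\<close>; every other vertex of
  \<open>A\<close> lies in the subtree of one of its children, which supplies
  \<open>X\<close>.\<close>

lemma root_of_tube:
  assumes "search_tree G T" "pseudo_graph G" "A \<in> tubes T"
  shows "\<exists>r\<in>A. \<forall>v\<in>A - {r}. \<exists>X\<in>tubes T. v \<in> X \<and> r \<notin> X \<and> X \<subseteq> A"
  using assms
proof (induction G T arbitrary: A rule: search_tree_tubes_induct)
  case (tree G T r f)
  show ?case
  proof (cases "A = verts G")
    case True
    have "\<exists>X\<in>tubes T. v \<in> X \<and> r \<notin> X \<and> X \<subseteq> A" if "v \<in> A - {r}" for v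
    proof -
      have "v \<in> \<Union> (verts ` pre_digraph.sccs (pre_digraph.del_vert G r))"
        unfolding tree(3) using that True by simp
      then obtain H where
        H: "H \<in> pre_digraph.sccs (pre_digraph.del_vert G r)" "v \<in> verts H"
        by blast
      have "verts H \<subseteq> verts G - {r}" using H(1) tree(3) by blast
      moreover have "verts H \<in> tubes T" using tree(6) tree(7)[OF H(1)] H(1) by auto
      ultimately show ?thesis
        using H(2) True by (intro bexI[of _ "verts H"]) auto
    qed
    then show ?thesis using True tree(2) by (intro bexI[of _ r]) auto
  next
    case False
    have "A \<in> insert (verts G) (\<Union>H\<in>pre_digraph.sccs (pre_digraph.del_vert G r). tubes (f H))"
      using tree(10) unfolding tree(6) .
    with False obtain H where
      H: "H \<in> pre_digraph.sccs (pre_digraph.del_vert G r)" "A \<in> tubes (f H)"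
      by blast
    have sub: "tubes (f H) \<subseteq> tubes T" unfolding tree(6) using H(1) by auto
    obtain s where s: "s \<in> A" "\<forall>v\<in>A - {s}. \<exists>X\<in>tubes (f H). v \<in> X \<and> s \<notin> X \<and> X \<subseteq> A"
      using tree(9)[OF H] by blast
    show ?thesis
    proof (rule bexI[OF ballI s(1)])
      fix v assume "v \<in> A - {s}"
      with s(2) obtain X where "X \<in> tubes (f H)" "v \<in> X" "s \<notin> X" "X \<subseteq> A" by blast
      then show "\<exists>X\<in>tubes T. v \<in> X \<and> s \<notin> X \<and> X \<subseteq> A"
        using sub by (intro bexI[of _ X]) auto
    qed
  qed
qed

text \<open>For adjacent \<open>u\<close> and \<open>v\<close> this says that \<open>u\<close> is an ancestor of \<open>v\<close>; incomparable vertices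
  are above each other.\<close>
definition above :: "'a rtree \<Rightarrow> 'a \<Rightarrow> 'a \<Rightarrow> bool" where
  "above T u v \<longleftrightarrow> (\<exists>X\<in>tubes T. v \<in> X \<and> u \<notin> X)"

lemma above_total:
  assumes "search_tree G T" "pseudo_graph G" "u \<in> verts G" "v \<in> verts G" "u \<noteq> v"
  shows "above T u v \<or> above T v u"
  using tubes_separate[OF assms] by (auto simp: above_def)

text \<open>Tubes separating \<open>u\<close> and \<open>v\<close> in both directions are proper, so
  each lies in a component of \<open>G - r\<close>. The edge joining \<open>u\<close> and
  \<open>v\<close> forces the two components to coincide, and induction applies there.\<close>

lemma above_asym:
  assumes "search_tree G T" "pseudo_graph G" "u \<rightarrow>\<^bsub>G\<^esub> v" "above T u v"
  shows "\<not> above T v u"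
  using assms
proof (induction rule: search_tree_tubes_induct)
  case (tree G T r f)
  interpret pseudo_graph G by fact
  let ?C = "pre_digraph.sccs (pre_digraph.del_vert G r)"
  have uv: "u \<in> verts G" "v \<in> verts G" using tree(10) by auto
  show ?case
  proof
    assume "above T v u"
    then obtain Y where Y: "Y \<in> tubes T" "u \<in> Y" "v \<notin> Y" by (auto simp: above_def)
    obtain X where X: "X \<in> tubes T" "v \<in> X" "u \<notin> X" using tree(11) by (auto simp: above_def)
    obtain H where H: "H \<in> ?C" "X \<in> tubes (f H)" using X uv unfolding tree(6) by auto
    obtain K where K: "K \<in> ?C" "Y \<in> tubes (f K)" using Y uv unfolding tree(6) by auto
    have mem: "v \<in> verts H" "u \<in> verts K"
      using tree(8)[OF H] tree(8)[OF K] X(2) Y(2) by auto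
    then have "u \<in> \<Union> (verts ` ?C)" "v \<in> \<Union> (verts ` ?C)" using H(1) K(1) by auto
    then have ne: "u \<noteq> r" "v \<noteq> r" unfolding tree(3) by auto
    have "u \<rightarrow>\<^bsub>H\<^esub> v" "u \<in> verts H" using tree(5)[OF H(1) tree(10) ne] mem by auto
    moreover from this have "H = K" using tree(4)[OF H(1) K(1)] mem by blast
    ultimately show False
      using tree(9)[OF H(1)] X Y H K by (auto simp: above_def)
  qed
qed

text \<open>Elimination in increasing order of \<open>f\<close>: a minimiser of \<open>f\<close>
  becomes the root, and the construction recurses into the components. Edges between vertices of
  equal value are left unconstrained. Integer values allow the order to be reversed by
  negation.\<close>

lemma search_tree_of_order:
  fixes f :: "'a \<Rightarrow> int"
  assumes "pseudo_graph G" "verts G \<noteq> {}"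
  shows "\<exists>T. search_tree G T \<and> (\<forall>u v. u \<rightarrow>\<^bsub>G\<^esub> v \<and> f u < f v \<longrightarrow> above T u v)"
  using assms
proof (induction "card (verts G)" arbitrary: G rule: less_induct)
  case less
  interpret pseudo_graph G by fact
  obtain r where r: "r \<in> verts G" "\<And>v. v \<in> verts G \<Longrightarrow> f r \<le> f v"
    using less(3) arg_min_if_finite[of "verts G" f] by (metis finite_verts not_le_imp_less)
  interpret D: pseudo_graph "del_vert r" by (rule pseudo_graph_del_vert)
  let ?Q = "\<lambda>H T. search_tree H T \<and> (\<forall>u v. u \<rightarrow>\<^bsub>H\<^esub> v \<and> f u < f v \<longrightarrow> above T u v)"
  have sub: "verts H \<subseteq> verts G - {r}" if "H \<in> D.sccs" for H
    using D.Union_verts_sccs that by (auto simp: verts_del_vert)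
  have "\<exists>T. ?Q H T" if H: "H \<in> D.sccs" for H
  proof (rule less(1))
    show "card (verts H) < card (verts G)"
      using sub[OF H] r(1) by (intro psubset_card_mono) auto
    show "pseudo_graph H" using H by (rule D.pseudo_graph_sccs)
    show "verts H \<noteq> {}" using H by (auto simp: D.sccs_def strongly_connected_def)
  qed
  then obtain t where t: "\<And>H. H \<in> D.sccs \<Longrightarrow> ?Q H (t H)" by metis
  have "finite D.sccs"
    using D.finite_sccs_verts D.inj_on_verts_sccs by (simp add: D.sccs_verts_conv finite_image_iff)
  then have fs: "fset (Abs_fset (t ` D.sccs)) = t ` D.sccs" by (simp add: Abs_fset_inverse)
  let ?T = "Node r (Abs_fset (t ` D.sccs))"
  have T: "search_tree G ?T" using r(1) t fs by (intro search_tree.intros) auto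
  have tubes: "tubes ?T = insert (tree_verts ?T) (\<Union>H\<in>D.sccs. tubes (t H))"
    using fs by (simp add: tubes_Node)
  have "above ?T u v" if uv: "u \<rightarrow>\<^bsub>G\<^esub> v" "f u < f v" for u v
  proof -
    have mem: "u \<in> verts G" "v \<in> verts G" using uv(1) by auto
    then have "v \<noteq> r" using r(2)[of u] uv(2) by auto
    then obtain H where H: "H \<in> D.sccs" "v \<in> verts H"
      using mem D.Union_verts_sccs by (auto simp: verts_del_vert)
    show ?thesis
    proof (cases "u = r")
      case True
      \<comment> \<open>Below the root, the vertex set of the whole component of \<open>v\<close> is
        the tube that witnesses \<open>above\<close>.\<close>
      have "t H \<in> subtrees (t H)" by (cases "t H") auto
      then have "verts H \<in> tubes (t H)"
        using tree_verts_search_tree[of H "t H"] D.pseudo_graph_sccs[OF H(1)] t[OF H(1)]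
        by (force simp: tubes_def)
      then show ?thesis using H sub[OF H(1)] True tubes by (auto simp: above_def)
    next
      case False
      then have "u \<rightarrow>\<^bsub>del_vert r\<^esub> v"
        using uv(1) \<open>v \<noteq> r\<close> by (force simp: arcs_ends_conv del_vert_simps)
      then have "u \<rightarrow>\<^bsub>H\<^esub> v" using D.arc_in_scc H by blast
      then have "above (t H) u v" using t[OF H(1)] uv(2) by blast
      then show ?thesis using H(1) tubes by (auto simp: above_def)
    qed
  qed
  then show ?case using T by blast
qed

section \<open>Rotations reverse at most one edge\<close>

text \<open>For search trees, an edge that changes direction contributes a single ordered pair, with
  its upper end in \<open>S\<close> first, so the cardinality counts edges rather than arcs.\<close>

definition reversed :: "('a, 'b) pre_digraph \<Rightarrow> 'a rtree \<Rightarrow> 'a rtree \<Rightarrow> ('a \<times> 'a) set" where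
  "reversed G S T = {(u, v). u \<rightarrow>\<^bsub>G\<^esub> v \<and> above S u v \<and> above T v u}"

lemma finite_reversed:
  assumes "fin_digraph G"
  shows "finite (reversed G S T)"
  using finite_subset[of "reversed G S T" "arcs_ends G"] fin_digraph.finite_arcs[OF assms]
  by (auto simp: reversed_def arcs_ends_def)

lemma card_reversed_rotation:
  assumes S: "search_tree G S" and T: "search_tree G T" and G: "pseudo_graph G"
    and rot: "rotation S T"
  shows "card (reversed G S T) \<le> 1"
proof -
  interpret pseudo_graph G by fact
  let ?A = "tubes S - tubes T" and ?B = "tubes T - tubes S"
  \<comment> \<open>An infinite set has \<open>card\<close> 0, so cardinality 2 yields
    finiteness.\<close>
  have fin: "finite (?A \<union> ?B)" using rot card_ge_0_finite[of "?A \<union> ?B"] by (simp add: rotation_def)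
  have disj: "?A \<inter> ?B = {}" by blast
  have sum: "card ?A + card ?B = 2"
    using rot fin disj by (simp add: rotation_def card_Un_disjoint)
  \<comment> \<open>a tube that sees the reversal is lost, so both differences are nonempty and hence singletons\<close>
  have lost: "X \<notin> tubes T"
    if "(u, v) \<in> reversed G S T" "v \<in> X" "u \<notin> X" for u v X
    using that above_asym[OF T G, of u v] by (auto simp: reversed_def above_def)
  have gained: "X \<notin> tubes S"
    if "(u, v) \<in> reversed G S T" "u \<in> X" "v \<notin> X" for u v X
    using that above_asym[OF S G, of u v] by (auto simp: reversed_def above_def)
  have eq: "p = q" if p: "p \<in> reversed G S T" and q: "q \<in> reversed G S T" for p q
  proof -
    obtain u v where uv: "p = (u, v)" "(u, v) \<in> reversed G S T" using p by (cases p) auto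
    obtain u' v' where uv': "q = (u', v')" "(u', v') \<in> reversed G S T" using q by (cases q) auto
    obtain A where A: "A \<in> ?A"
      using uv(2) lost[OF uv(2)] by (auto simp: reversed_def above_def)
    obtain B where B: "B \<in> ?B"
      using uv(2) gained[OF uv(2)] by (auto simp: reversed_def above_def)
    have "card ?A > 0" "card ?B > 0" using A B fin by (auto simp: card_gt_0_iff)
    with sum have "card ?A = 1" "card ?B = 1" by auto
    then have AB: "?A = {A}" "?B = {B}" using A B by (metis card_1_singletonE singletonD)+
    obtain a where a: "a \<in> A" "\<And>w. w \<in> A - {a} \<Longrightarrow> \<exists>X\<in>tubes S. w \<in> X \<and> a \<notin> X \<and> X \<subseteq> A"
      using root_of_tube[OF S G, of A] A by blast
    obtain b where b: "b \<in> B" "\<And>w. w \<in> B - {b} \<Longrightarrow> \<exists>X\<in>tubes T. w \<in> X \<and> b \<notin> X \<and> X \<subseteq> B"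
      using root_of_tube[OF T G, of B] B by blast
    have "x = b \<and> y = a" if xy: "(x, y) \<in> reversed G S T" for x y
    proof -
      have only_A: "X = A" if "X \<in> tubes S" "y \<in> X" "x \<notin> X" for X
        using that lost[OF xy] AB by blast
      have only_B: "X = B" if "X \<in> tubes T" "x \<in> X" "y \<notin> X" for X
        using that gained[OF xy] AB by blast
      have "y \<in> A" "x \<notin> A" "x \<in> B" "y \<notin> B"
        using xy only_A only_B by (auto simp: reversed_def above_def)
      \<comment> \<open>If \<open>y\<close> were not the root \<open>a\<close> of \<open>A\<close>,
        some tube of \<open>S\<close> inside \<open>A\<close> would contain \<open>y\<close> but
        neither \<open>a\<close> nor \<open>x\<close>. By \<open>only_A\<close> it would equal
        \<open>A\<close>, although \<open>a\<close> is in \<open>A\<close>. The same argument in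
        \<open>T\<close> gives \<open>x = b\<close>.\<close>
      then show ?thesis using a b only_A only_B by (metis DiffI singletonD subsetD)
    qed
    then show ?thesis using uv uv' by blast
  qed
  then show ?thesis by (metis card_le_Suc0_iff_eq finite_reversed fin_digraph_axioms One_nat_def)
qed

section \<open>Reversed edges bound distances in the rotation graph\<close>

text \<open>By totality \<open>T\<close> orients every edge, and this orientation disagrees with
  that of \<open>S\<close> or with that of \<open>U\<close> whenever those two are opposite.\<close>

lemma reversed_triangle:
  assumes "search_tree G T" "pseudo_graph G" "loopfree_digraph G"
  shows "reversed G S U \<subseteq> reversed G S T \<union> reversed G T U"
proof (clarsimp simp: reversed_def)
  fix u v
  assume uv: "u \<rightarrow>\<^bsub>G\<^esub> v" "above S u v" "above U v u" "\<not> above T u v"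
  interpret pseudo_graph G by fact
  interpret loopfree_digraph G by fact
  have "u \<in> verts G" "v \<in> verts G" "u \<noteq> v" using uv(1) by (auto dest: adj_not_same)
  with assms(1,2) uv(4) show "above T v u" using above_total by metis
qed

text \<open>Every arc of the walk is a rotation and contributes at most one reversed edge; the
  triangle inclusion adds these contributions up.\<close>

lemma card_reversed_awalk:
  assumes G: "graph G"
    and "pre_digraph.awalk (with_proj (rotation_graph G)) S p T"
  shows "card (reversed G S T) \<le> length p"
proof -
  interpret graph G by fact
  interpret R: pair_sym_digraph "rotation_graph G" by (rule pair_sym_digraph_rotation_graph)
  from assms(2) show ?thesis
  proof (induction p arbitrary: S)
    case Nil
    then have "S \<in> pverts (rotation_graph G) \<and> S = T" by (auto simp: R.awalk_Nil_iff)
    then have "search_tree G S" "S = T" by (auto simp: rotation_graph_def)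
    then have "reversed G S T = {}"
      using above_asym[OF _ pseudo_graph_axioms] by (auto simp: reversed_def)
    then show ?case by simp
  next
    case (Cons e p)
    obtain U where e: "e = (S, U)" "(S, U) \<in> parcs (rotation_graph G)" "R.awalk U p T"
      using Cons.prems by (cases e) (auto simp: R.awalk_Cons_iff)
    then have S: "search_tree G S" and U: "search_tree G U" and rot: "rotation S U"
      by (auto simp: rotation_graph_def)
    have "card (reversed G S T) \<le> card (reversed G S U \<union> reversed G U T)"
      using reversed_triangle[OF U pseudo_graph_axioms loopfree_digraph_axioms]
      by (intro card_mono) (auto simp: finite_reversed fin_digraph_axioms)
    also have "\<dots> \<le> card (reversed G S U) + card (reversed G U T)" by (rule card_Un_le)
    also have "\<dots> \<le> length (e # p)"
      using card_reversed_rotation[OF S U pseudo_graph_axioms rot] Cons.IH[OF e(3)] by simp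
    finally show ?case .
  qed
qed

text \<open>The two distant trees come from eliminating by \<open>f\<close> and by
  \<open>- f\<close>. For injective \<open>f\<close> on a loopless graph the set counts every edge
  once.\<close>

lemma diameter_rotation_graph_ge:
  fixes f :: "'a \<Rightarrow> int"
  assumes G: "graph G" and ne: "verts G \<noteq> {}"
  shows "ereal (real (card {(u, v). u \<rightarrow>\<^bsub>G\<^esub> v \<and> f u < f v})) \<le> diameter (rotation_graph G)"
proof -
  interpret graph G by fact
  interpret R: pair_sym_digraph "rotation_graph G" by (rule pair_sym_digraph_rotation_graph)
  let ?E = "{(u, v). u \<rightarrow>\<^bsub>G\<^esub> v \<and> f u < f v}"
  obtain S where S: "search_tree G S" "\<And>u v. u \<rightarrow>\<^bsub>G\<^esub> v \<Longrightarrow> f u < f v \<Longrightarrow> above S u v"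
    using search_tree_of_order[OF pseudo_graph_axioms ne, of f] by blast
  obtain T where T: "search_tree G T" "\<And>u v. u \<rightarrow>\<^bsub>G\<^esub> v \<Longrightarrow> - f u < - f v \<Longrightarrow> above T u v"
    using search_tree_of_order[OF pseudo_graph_axioms ne, of "\<lambda>v. - f v"] by blast
  \<comment> \<open>For \<open>(u, v)\<close> in \<open>?E\<close> the opposite arc, present by
    symmetry, increases \<open>- f\<close>, so \<open>T\<close> puts \<open>v\<close> above
    \<open>u\<close>.\<close>
  have "?E \<subseteq> reversed G S T"
    using S(2) T(2) graph_symmetric by (auto simp: reversed_def)
  then have le: "card ?E \<le> card (reversed G S T)"
    by (intro card_mono finite_reversed fin_digraph_axioms)
  \<comment> \<open>\<open>\<mu>\<close> is an infimum over walks, and with unit weights the cost of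
    a walk is its length.\<close>
  have "ereal (real (card ?E)) \<le> R.\<mu> (\<lambda>_. 1) S T"
    unfolding R.\<mu>_def
  proof (intro INF_greatest)
    fix p assume "p \<in> {p. R.awalk S p T}"
    then have "card ?E \<le> length p" using card_reversed_awalk[OF G] le by force
    then show "ereal (real (card ?E)) \<le> ereal (R.awalk_cost (\<lambda>_. 1) p)"
      by (simp add: R.awalk_cost_def sum_list_triv)
  qed
  also have "\<dots> \<le> diameter (rotation_graph G)"
    unfolding diameter_def using S(1) T(1)
    by (intro SUP_upper2[of S] SUP_upper2[of T]) (auto simp: rotation_graph_def)
  finally show ?thesis .
qed

section \<open>Pathwidth and cliques\<close>

text \<open>Of all bags in which some vertex of the clique occurs for the first time, the last one
  contains the whole clique.\<close>
lemma clique_in_bag: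
  assumes pd: "path_decomposition G Xs" and K: "finite K" "K \<noteq> {}" "K \<subseteq> verts G"
    and clique: "\<And>u v. u \<in> K \<Longrightarrow> v \<in> K \<Longrightarrow> u \<noteq> v \<Longrightarrow> u \<rightarrow>\<^bsub>G\<^esub> v"
  shows "\<exists>X\<in>set Xs. K \<subseteq> X"
proof -
  define first where "first v = (LEAST i. i < length Xs \<and> v \<in> Xs ! i)" for v
  have first: "first v < length Xs" "v \<in> Xs ! first v" if "v \<in> K" for v
  proof -
    have "\<exists>i<length Xs. v \<in> Xs ! i"
      using pd K(3) that by (fastforce simp: path_decomposition_def in_set_conv_nth)
    then have "first v < length Xs \<and> v \<in> Xs ! first v"
      unfolding first_def by (rule LeastI_ex)
    then show "first v < length Xs" "v \<in> Xs ! first v" by auto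
  qed
  have first_le: "first v \<le> i" if "i < length Xs" "v \<in> Xs ! i" for v i
    unfolding first_def using that by (intro Least_le) simp
  obtain v where v: "v \<in> K" "\<And>u. u \<in> K \<Longrightarrow> first u \<le> first v"
    using obtains_MAX[OF K(1,2), of first] K(1) by (metis Max_ge finite_imageI imageI)
  have "u \<in> Xs ! first v" if u: "u \<in> K" for u
  proof (cases "u = v")
    case True
    then show ?thesis using first u by simp
  next
    case False
    then have "\<exists>X\<in>set Xs. u \<in> X \<and> v \<in> X"
      using pd clique[OF u v(1)] by (auto simp: path_decomposition_def)
    then obtain i where i: "i < length Xs" "u \<in> Xs ! i" "v \<in> Xs ! i"
      by (auto simp: in_set_conv_nth)
    \<comment> \<open>The bag at \<open>first v\<close> lies between the first bag containing
      \<open>u\<close> and a bag containing both vertices, so the interval condition puts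
      \<open>u\<close> into it.\<close>
    have "first u \<le> first v" "first v \<le> i" using v(2)[OF u] first_le i by auto
    then have "Xs ! first u \<inter> Xs ! i \<subseteq> Xs ! first v"
      using pd i(1) unfolding path_decomposition_def by blast
    then show ?thesis using first(2)[OF u] i by blast
  qed
  then show ?thesis using first(1)[OF v(1)] nth_mem by blast
qed

lemma width_ge_clique:
  assumes pd: "path_decomposition G Xs" and G: "finite (verts G)" and K: "K \<subseteq> verts G"
    and clique: "\<And>u v. u \<in> K \<Longrightarrow> v \<in> K \<Longrightarrow> u \<noteq> v \<Longrightarrow> u \<rightarrow>\<^bsub>G\<^esub> v"
  shows "card K - 1 \<le> width Xs"
proof (cases "K = {}")
  case False
  obtain X where X: "X \<in> set Xs" "K \<subseteq> X"
    using clique_in_bag[OF pd finite_subset[OF K G] False K clique] by blast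
  have "X \<subseteq> verts G" using pd X(1) by (auto simp: path_decomposition_def)
  then have "card K \<le> card X" using G X(2) by (meson card_mono finite_subset)
  also have "\<dots> \<le> Max (card ` set Xs)" using X(1) by simp
  finally show ?thesis by (simp add: width_def)
qed simp

section \<open>Windmill graphs\<close>

text \<open>Blades of \<open>m\<close> consecutive vertices, joined to the centre \<open>0\<close>; the last one is incomplete
  unless \<open>m\<close> divides \<open>n\<close>.\<close>
definition windmill :: "nat \<Rightarrow> nat \<Rightarrow> (nat, nat \<times> nat) pre_digraph" where
  "windmill m n =
     \<lparr> verts = {..n},
       arcs = {(u, v). u \<le> n \<and> v \<le> n \<and> u \<noteq> v \<and>
                 (u = 0 \<or> v = 0 \<or> (u - 1) div m = (v - 1) div m)},
       tail = fst, head = snd \<rparr>"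

lemma verts_windmill [simp]: "verts (windmill m n) = {..n}"
  by (simp add: windmill_def)

lemma windmill_adj:
  "u \<rightarrow>\<^bsub>windmill m n\<^esub> v \<longleftrightarrow>
     u \<le> n \<and> v \<le> n \<and> u \<noteq> v \<and> (u = 0 \<or> v = 0 \<or> (u - 1) div m = (v - 1) div m)"
  by (auto simp: windmill_def arcs_ends_def arc_to_ends_def)

lemma graph_windmill: "graph (windmill m n)"
proof -
  have "finite (arcs (windmill m n))"
    by (rule finite_subset[of _ "{..n} \<times> {..n}"]) (auto simp: windmill_def)
  moreover have "symmetric (windmill m n)"
    unfolding symmetric_def sym_def windmill_adj by auto
  ultimately show ?thesis
    by unfold_locales (auto simp: windmill_def arc_to_ends_def)
qed

lemma connected_windmill: "connected (windmill m n)"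
  unfolding connected_def
proof (rule strongly_connectedI)
  interpret graph "windmill m n" by (rule graph_windmill)
  fix u v assume "u \<in> verts (with_proj (mk_symmetric (windmill m n)))"
    "v \<in> verts (with_proj (mk_symmetric (windmill m n)))"
  then have uv: "u \<le> n" "v \<le> n" by auto
  have "u \<rightarrow>\<^sup>*\<^bsub>windmill m n\<^esub> 0"
    using uv by (cases "u = 0") (auto simp: windmill_adj)
  also have "0 \<rightarrow>\<^sup>*\<^bsub>windmill m n\<^esub> v"
    using uv by (cases "v = 0") (auto simp: windmill_adj)
  finally show "u \<rightarrow>\<^sup>*\<^bsub>with_proj (mk_symmetric (windmill m n))\<^esub> v"
    by (rule reachable_mk_symmetricI)
qed auto

lemma interval_graph_windmill: "interval_graph (windmill m n)"
proof -
  \<comment> \<open>Every vertex of blade \<open>i\<close> gets the single point \<open>i\<close>;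
    the centre gets \<open>[0, n]\<close>, which is long enough to contain all these points.\<close>
  define l h :: "nat \<Rightarrow> real" where
    "l v = (if v = 0 then 0 else real ((v - 1) div m))" and
    "h v = (if v = 0 then real n else real ((v - 1) div m))" for v
  have le: "(v - 1) div m \<le> n" if "v \<le> n" for v
    using that by (intro order_trans[OF div_le_dividend]) simp
  have "u \<rightarrow>\<^bsub>windmill m n\<^esub> v \<longleftrightarrow> {l u..h u} \<inter> {l v..h v} \<noteq> {}"
    if "u \<le> n" "v \<le> n" "u \<noteq> v" for u v
    using that le[of u] le[of v]
    by (cases "u = 0"; cases "v = 0") (auto simp: windmill_adj l_def h_def)
  moreover have "l v \<le> h v" for v by (simp add: l_def h_def)
  ultimately show ?thesis unfolding interval_graph_def verts_windmill by blast
qed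

text \<open>Each blade together with the centre is one bag of \<open>m + 1\<close> vertices, giving
  the upper bound. Such a bag is also a clique, giving the lower bound.\<close>

lemma pathwidth_windmill:
  assumes m: "m > 0" and q: "q > 0"
  shows "pathwidth (windmill m (q * m)) = m"
proof -
  let ?G = "windmill m (q * m)"
  interpret graph ?G by (rule graph_windmill)
  define B where "B i = insert 0 {i * m + 1..i * m + m}" for i
  define Xs where "Xs = map B [0..<q]"
  \<comment> \<open>In this form membership matches adjacency in the windmill. Distinct bags share
    only the centre, which lies in all of them, so the interval condition follows at once.\<close>
  have B_iff: "v \<in> B i \<longleftrightarrow> v = 0 \<or> (v - 1) div m = i" for v i
  proof (cases v)
    case (Suc w)
    have "w div m = i \<longleftrightarrow> i * m \<le> w \<and> w < i * m + m"
      using m by (metis add.commute div_nat_eqI dividend_less_div_times mult.commute mult_Suc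
          times_div_less_eq_dividend)
    then show ?thesis using Suc by (auto simp: B_def)
  qed (simp add: B_def)
  have block_lt: "(v - 1) div m < q" if "v \<le> q * m" for v
    using that m q by (intro less_mult_imp_div_less) (cases v, auto)
  have B_sub: "B i \<subseteq> {..q * m}" if "i < q" for i
  proof -
    have "Suc i * m \<le> q * m" using that by (intro mult_le_mono1) simp
    then show ?thesis by (auto simp: B_def)
  qed
  have pd: "path_decomposition ?G Xs"
    unfolding path_decomposition_def
  proof (intro conjI allI impI)
    show "Xs \<noteq> []" using q by (simp add: Xs_def)
    show "(\<Union>X\<in>set Xs. X) = verts ?G"
    proof (intro equalityI subsetI)
      fix v assume "v \<in> verts ?G"
      then show "v \<in> (\<Union>X\<in>set Xs. X)"
        using block_lt[of v] by (auto simp: Xs_def B_iff)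
    qed (use B_sub in \<open>fastforce simp: Xs_def\<close>)
  next
    fix u v assume uv: "u \<rightarrow>\<^bsub>?G\<^esub> v"
    show "\<exists>X\<in>set Xs. u \<in> X \<and> v \<in> X"
      using uv block_lt[of u] block_lt[of v]
      by (cases "u = 0") (auto simp: Xs_def B_iff windmill_adj)
  next
    fix i j l assume "i \<le> j \<and> j \<le> l \<and> l < length Xs"
    then show "Xs ! i \<inter> Xs ! l \<subseteq> Xs ! j"
      by (auto simp: Xs_def B_iff)
  qed
  have card_B: "card (B i) = Suc m" for i by (simp add: B_def)
  have "card ` set Xs = {Suc m}" using q by (auto simp: Xs_def card_B image_iff)
  then have "width Xs = m" by (simp add: width_def)
  moreover have "m \<le> width Ys" if "path_decomposition ?G Ys" for Ys
  proof -
    have "card (B 0) - 1 \<le> width Ys"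
      using B_sub[OF q] B_iff[of _ 0]
      by (intro width_ge_clique[OF that]) (auto simp: windmill_adj subset_iff simp del: One_nat_def)
    then show ?thesis by (simp add: card_B)
  qed
  ultimately show ?thesis
    unfolding pathwidth_def using pd by (intro Least_equality) auto
qed

section \<open>Counting the edges of a windmill\<close>

text \<open>The range splits into \<open>q\<close> blocks of length \<open>m\<close>, and each block
  contributes \<open>1 + ... + m\<close>. Doubling avoids division.\<close>

lemma sum_mod_blocks: "2 * (\<Sum>i<q * m. Suc (i mod m)) = q * m * Suc m" for m q :: nat
proof -
  have "(\<Sum>i<q * m. Suc (i mod m)) = (\<Sum>j<q. \<Sum>i\<in>{j * m..<j * m + m}. Suc (i mod m))"
    by (rule sum.nat_group[symmetric])
  also have "\<dots> = (\<Sum>j<q. \<Sum>i<m. Suc i)"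
  proof (rule sum.cong[OF refl])
    fix j
    have "(\<Sum>i\<in>{j * m..<j * m + m}. Suc (i mod m)) = (\<Sum>i\<in>{0..<m}. Suc ((i + j * m) mod m))"
      using sum.shift_bounds_nat_ivl[of "\<lambda>i. Suc (i mod m)" 0 "j * m" m] by (simp add: add.commute)
    then show "(\<Sum>i\<in>{j * m..<j * m + m}. Suc (i mod m)) = (\<Sum>i<m. Suc i)"
      by (simp add: atLeast0LessThan)
  qed
  finally have "(\<Sum>i<q * m. Suc (i mod m)) = q * (\<Sum>i<m. Suc i)" by simp
  moreover have "2 * (\<Sum>i<m. Suc i) = m * Suc m" by (induction m) auto
  ultimately show ?thesis by (metis mult.assoc mult.left_commute)
qed

lemma card_windmill_edges:
  assumes m: "m > 0"
  shows "2 * card {(u, v). u \<rightarrow>\<^bsub>windmill m (q * m)\<^esub> v \<and> u < v} = q * m * Suc m"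
proof -
  let ?n = "q * m"
  \<comment> \<open>\<open>L i\<close> consists of the neighbours of vertex \<open>Suc i\<close>
    that are smaller than it: the centre and the earlier vertices of its blade, which starts at
    \<open>m * (i div m) + 1\<close>. There are \<open>1 + i mod m\<close> of them.\<close>
  define L where "L i = insert 0 {m * (i div m) + 1..i}" for i
  have L: "u \<in> L i \<longleftrightarrow> u < Suc i \<and> (u = 0 \<or> (u - 1) div m = i div m)" for u i
  proof (cases u)
    case (Suc w)
    have "m * (i div m) \<le> w \<longleftrightarrow> w div m = i div m" if "w < i"
      using that m by (metis div_le_mono div_mult_self1_is_m le_antisym less_imp_le
          times_div_less_eq_dividend)
    then show ?thesis using Suc by (auto simp: L_def)
  qed (simp add: L_def)
  have card_L: "card (L i) = Suc (i mod m)" for i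
    by (simp add: L_def minus_mult_div_eq_mod)
  \<comment> \<open>Edges are sorted by their larger end, which is never \<open>0\<close> and hence
    of the form \<open>Suc i\<close> with \<open>i < q * m\<close>.\<close>
  have "{(u, v). u \<rightarrow>\<^bsub>windmill m ?n\<^esub> v \<and> u < v} = (\<lambda>(i, u). (u, Suc i)) ` (SIGMA i:{..<?n}. L i)"
  proof (intro equalityI subsetI)
    fix p assume "p \<in> {(u, v). u \<rightarrow>\<^bsub>windmill m ?n\<^esub> v \<and> u < v}"
    then obtain u v where p: "p = (u, v)" "u \<rightarrow>\<^bsub>windmill m ?n\<^esub> v" "u < v" by auto
    then obtain i where i: "v = Suc i" by (cases v) auto
    have "(i, u) \<in> (SIGMA i:{..<?n}. L i)" using p i by (auto simp: L windmill_adj)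
    then show "p \<in> (\<lambda>(i, u). (u, Suc i)) ` (SIGMA i:{..<?n}. L i)" using p i by force
  qed (auto simp: L windmill_adj)
  moreover have "inj_on (\<lambda>(i, u). (u, Suc i)) (SIGMA i:{..<?n}. L i)"
    by (auto simp: inj_on_def)
  ultimately have "card {(u, v). u \<rightarrow>\<^bsub>windmill m ?n\<^esub> v \<and> u < v} = (\<Sum>i<?n. card (L i))"
    by (simp add: card_image L_def)
  then show ?thesis using sum_mod_blocks[where m = m and q = q] by (simp add: card_L)
qed

theorem theorem16:
  fixes k n :: nat
  assumes "k \<ge> 2" and "n > 0" and "(k - 1) dvd n"
  shows "\<exists>G :: (nat, nat \<times> nat) pre_digraph.
           graph G \<and> connected G \<and> interval_graph G \<and>
           card (verts G) = n + 1 \<and> pathwidth G = k - 1 \<and>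
           diameter (rotation_graph G) \<ge> ereal (real n * real k / 2)"
proof -
  \<comment> \<open>Blades of \<open>k - 1\<close> vertices form cliques of size \<open>k\<close>
    with the centre, and \<open>q\<close> such blades use up the \<open>n\<close> other
    vertices.\<close>
  define m where "m = k - 1"
  have m: "m > 0" "k = Suc m" using assms(1) by (auto simp: m_def)
  obtain q where n: "n = q * m" using assms(3) unfolding m_def by (metis dvdE mult.commute)
  then have q: "q > 0" using assms(2) by (cases q) auto
  let ?G = "windmill m n"
  \<comment> \<open>The elimination order is the numbering of the vertices itself;
    \<open>int\<close> is injective, so all \<open>n * k / 2\<close> edges are counted.\<close>
  have "2 * card {(u, v). u \<rightarrow>\<^bsub>?G\<^esub> v \<and> int u < int v} = n * k"
    using card_windmill_edges[OF m(1), of q] m(2) n by simp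
  then have "real (2 * card {(u, v). u \<rightarrow>\<^bsub>?G\<^esub> v \<and> int u < int v}) = real (n * k)"
    by (rule arg_cong)
  then have "real n * real k / 2 = real (card {(u, v). u \<rightarrow>\<^bsub>?G\<^esub> v \<and> int u < int v})"
    by simp
  then have "ereal (real n * real k / 2) \<le> diameter (rotation_graph ?G)"
    using diameter_rotation_graph_ge[OF graph_windmill, of m n int] by simp
  moreover have "pathwidth ?G = k - 1"
    using pathwidth_windmill[OF m(1) q] m(2) n by simp
  ultimately show ?thesis
    by (intro exI[of _ ?G] conjI)
      (simp_all add: graph_windmill connected_windmill interval_graph_windmill)
qed

end
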